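(* Let $\mathsf{k}$ be a field and let $A=\bigoplus_{n\ge 0}A_n$ be an affine $\mathbb{N}$-graded $\mathsf{k}$-algebra with all $A_n$ finite dimensional. If $\mathrm{H}(A)>1$, then $A$ has exponential growth. Hence, if $\operatorname{GKdim}(A)<\infty$, then $\mathrm{H}(A)=1$ or $\mathrm{H}(A)=0$.
   Context: All algebras are associative and unital over an arbitrary base field $\mathsf{k}$; $\mathbb{N}=\{0,1,2,\dots\}$. An algebra is affine if it is finitely generated as an algebra. $\mathbb{N}$-graded means $A=\bigoplus_{n\ge0}A_n$ with subspaces $A_n$ satisfying $A_nA_m\subseteq A_{n+m}$. The entropy of $A$ is $\mathrm{H}(A)=\limsup_{n\to\infty}\sqrt[n]{\dim A_n}$. For a subspace $V\subseteq A$, put $V^0=\mathsf{k}$ and, for $m>0$, $V^m=\operatorname{span}\{a_1\cdots a_m : a_j\in V\}$. For a finite-dimensional generating subspace $V$ of an affine algebra $A$, let $d_V(n)=\dim\left(\sum_{i=0}^n V^i\right)$. The Gelfand-Kirillov dimension is $\operatorname{GKdim}(A)=\limsup_{n\to\infty}\frac{\log d_V(n)}{\log n}$ (independent of $V$). Growth: let $\Phi$ be the set of functions $f:\mathbb{N}\to\mathbb{R}$ such that $f(n)>0$ and $f(n+1)\ge f(n)$ for all sufficiently large $n$. Write $f\le^* g$ if there are $c,m\in\mathbb{N}$ with $f(n)\le c\,g(mn)$ for all $n\in\mathbb{N}$, and $f\sim g$ if $f\le^* g$ and $g\le^* f$. $\mathcal{G}(f)$ denotes the class of $f$ in $\Phi/\sim$,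 and $\mathcal{G}(A)=\mathcal{G}(d_V)$, which is independent of $V$. $A$ has exponential growth if $\mathcal{G}(A)$ equals $\mathcal{E}_1$, the growth of $n\mapsto e^n$. *)

theory Defs
  imports Complex_Main "HOL-Library.Extended_Real"
begin

section \<open>Growth classes of functions\<close>

definition eventually_pos_mono :: "(nat \<Rightarrow> real) set" where
  "eventually_pos_mono = {f. \<forall>\<^sub>F n in sequentially. f n > 0 \<and> f (n + 1) \<ge> f n}"

definition growth_le :: "(nat \<Rightarrow> real) \<Rightarrow> (nat \<Rightarrow> real) \<Rightarrow> bool" where
  "growth_le f g \<longleftrightarrow> (\<exists>c m :: nat. \<forall>n. f n \<le> real c * g (m * n))"

definition growth_equiv :: "(nat \<Rightarrow> real) \<Rightarrow> (nat \<Rightarrow> real) \<Rightarrow> bool" where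
  "growth_equiv f g \<longleftrightarrow> growth_le f g \<and> growth_le g f"

definition growth_class :: "(nat \<Rightarrow> real) \<Rightarrow> (nat \<Rightarrow> real) set" where
  "growth_class f = {g \<in> eventually_pos_mono. growth_equiv f g}"

lemma growth_le_trans:
  assumes "growth_le f g" "growth_le g h"
  shows "growth_le f h"
proof -
  obtain c m :: nat where 1: "\<And>n. f n \<le> real c * g (m * n)"
    using assms(1) unfolding growth_le_def by blast
  obtain d k :: nat where 2: "\<And>n. g n \<le> real d * h (k * n)"
    using assms(2) unfolding growth_le_def by blast
  have "f n \<le> real (c * d) * h ((k * m) * n)" for n
  proof -
    have "real c * g (m * n) \<le> real c * (real d * h (k * (m * n)))"
      by (intro mult_left_mono 2) auto
    with 1[of n] show ?thesis by (simp add: mult.assoc)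
  qed
  then show ?thesis unfolding growth_le_def by blast
qed

lemma growth_class_cong: "growth_equiv f g \<Longrightarrow> growth_class f = growth_class g"
  unfolding growth_class_def growth_equiv_def by (auto intro: growth_le_trans)


section \<open>Associative unital algebras over a field\<close>

text \<open>
  The type of the algebra has sort \<open>{ring, monoid_mult}\<close> rather than \<open>ring_1\<close>, which would
  exclude the zero algebra.
\<close>

locale unital_algebra = vector_space scale
  for scale :: "'k :: field \<Rightarrow> 'a :: {ring, monoid_mult} \<Rightarrow> 'a" +
  assumes scale_mult_left: "scale c x * y = scale c (x * y)"
    and scale_mult_right: "x * scale c y = scale c (x * y)"
begin

definition fin_dim :: "'a set \<Rightarrow> bool" where
  "fin_dim V \<longleftrightarrow> (\<exists>B. finite B \<and> V = span B)"

definition subalgebra :: "'a set \<Rightarrow> bool" where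
  "subalgebra B \<longleftrightarrow> subspace B \<and> 1 \<in> B \<and> (\<forall>x\<in>B. \<forall>y\<in>B. x * y \<in> B)"

definition generates :: "'a set \<Rightarrow> bool" where
  "generates S \<longleftrightarrow> subalgebra hull S = UNIV"

definition affine_algebra :: bool where
  "affine_algebra \<longleftrightarrow> (\<exists>S. finite S \<and> generates S)"

text \<open>The last conjunct says that the algebra is the internal direct sum of the \<open>A n\<close>.\<close>

definition graded :: "(nat \<Rightarrow> 'a set) \<Rightarrow> bool" where
  "graded A \<longleftrightarrow>
     (\<forall>n. subspace (A n)) \<and>
     (\<forall>n m. \<forall>x\<in>A n. \<forall>y\<in>A m. x * y \<in> A (n + m)) \<and>
     (\<forall>a. \<exists>!f. (\<forall>n. f n \<in> A n) \<and> finite {n. f n \<noteq> 0} \<and> a = (\<Sum>n | f n \<noteq> 0. f n))"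

definition entropy :: "(nat \<Rightarrow> 'a set) \<Rightarrow> ereal" where
  "entropy A = limsup (\<lambda>n. ereal (root n (real (dim (A n)))))"

text \<open>For \<open>m = 0\<close> the only product is the empty one, so \<open>subspace_power V 0\<close> is the line
  spanned by \<open>1\<close>.\<close>

definition subspace_power :: "'a set \<Rightarrow> nat \<Rightarrow> 'a set" where
  "subspace_power V m = span {prod_list xs | xs. length xs = m \<and> set xs \<subseteq> V}"

definition power_sum :: "'a set \<Rightarrow> nat \<Rightarrow> 'a set" where
  "power_sum V n = span (\<Union>i\<le>n. subspace_power V i)"

definition growth_fun :: "'a set \<Rightarrow> nat \<Rightarrow> nat" where
  "growth_fun V n = dim (power_sum V n)"

text \<open>For an affine algebra the two invariants below do not depend on the chosen space; see
  \<open>algebra_growth_eq\<close> and \<open>GKdim_eq\<close>. Since \<open>ln 0 = 0\<close>, \<open>GKdim\<close> of the zero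
  algebra comes out as \<open>0\<close> (by convention it is sometimes \<open>- \<infinity>\<close>).\<close>

definition generating_space :: "'a set \<Rightarrow> bool" where
  "generating_space V \<longleftrightarrow> subspace V \<and> fin_dim V \<and> generates V"

definition algebra_growth :: "(nat \<Rightarrow> real) set" where
  "algebra_growth = growth_class (\<lambda>n. real (growth_fun (SOME V. generating_space V) n))"

definition GKdim :: ereal where
  "GKdim = limsup (\<lambda>n. ereal (ln (real (growth_fun (SOME V. generating_space V) n)) / ln (real n)))"

definition exponential_growth :: bool where
  "exponential_growth \<longleftrightarrow> algebra_growth = growth_class (\<lambda>n. exp (real n))"


subsection \<open>Independence of the generating space\<close>

lemma span_mult:
  assumes "x \<in> span S" "y \<in> span T"
  shows "x * y \<in> span {a * b | a b. a \<in> S \<and> b \<in> T}" (is "_ \<in> span ?P")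
proof -
  have 1: "a * y \<in> span ?P" if "a \<in> S" for a
    using assms(2)
  proof (induction rule: span_induct_alt)
    case base
    then show ?case by (simp add: span_zero)
  next
    case (step c b z)
    have "a * b \<in> span ?P" using that step by (intro span_base) blast
    then show ?case using step by (simp add: distrib_left scale_mult_right span_add span_scale)
  qed
  show ?thesis
    using assms(1)
  proof (induction rule: span_induct_alt)
    case base
    then show ?case by (simp add: span_zero)
  next
    case (step c b z)
    then show ?case using 1 by (simp add: distrib_right scale_mult_left span_add span_scale)
  qed
qed

lemma subspace_power_mult:
  assumes "x \<in> subspace_power V i" "y \<in> subspace_power V j"
  shows "x * y \<in> subspace_power V (i + j)"
proof -
  let ?S = "\<lambda>i. {prod_list xs | xs. length xs = i \<and> set xs \<subseteq> V}"
  have "{a * b | a b. a \<in> ?S i \<and> b \<in> ?S j} \<subseteq> ?S (i + j)"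
  proof clarify
    fix xs ys assume "set xs \<subseteq> V" "set ys \<subseteq> V"
    then show "\<exists>zs. prod_list xs * prod_list ys = prod_list zs \<and>
        length zs = length xs + length ys \<and> set zs \<subseteq> V"
      by (intro exI[of _ "xs @ ys"]) auto
  qed
  from span_mono[OF this] span_mult[OF assms[unfolded subspace_power_def]]
  show ?thesis unfolding subspace_power_def by blast
qed

lemma subspace_power_subset: "i \<le> n \<Longrightarrow> subspace_power V i \<subseteq> power_sum V n"
  unfolding power_sum_def by (rule order_trans[OF _ span_superset]) blast

lemma power_sum_mono: "m \<le> n \<Longrightarrow> power_sum V m \<subseteq> power_sum V n"
  unfolding power_sum_def by (intro span_mono UN_mono) auto

lemma subspace_power_sum: "subspace (power_sum V n)"
  unfolding power_sum_def by (rule subspace_span)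

lemma power_sum_mult:
  assumes "x \<in> power_sum V i" "y \<in> power_sum V j"
  shows "x * y \<in> power_sum V (i + j)"
proof -
  have "{a * b | a b. a \<in> (\<Union>k\<le>i. subspace_power V k) \<and> b \<in> (\<Union>k\<le>j. subspace_power V k)}
      \<subseteq> power_sum V (i + j)"
  proof clarify
    fix a b k l assume "k \<le> i" "l \<le> j" "a \<in> subspace_power V k" "b \<in> subspace_power V l"
    then show "a * b \<in> power_sum V (i + j)"
      using subspace_power_mult[of a V k b l] subspace_power_subset[of "k + l" "i + j" V] by auto
  qed
  from span_minimal[OF this subspace_power_sum] span_mult[OF assms[unfolded power_sum_def]]
  show ?thesis by blast
qed

lemma one_in_power_sum: "1 \<in> power_sum V n"
proof -
  have "1 \<in> subspace_power V 0"
    unfolding subspace_power_def by (rule span_base) auto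
  then show ?thesis using subspace_power_subset[of 0 n V] by blast
qed

lemma subset_power_sum: "V \<subseteq> power_sum V 1"
proof
  fix x assume "x \<in> V"
  then have "x \<in> subspace_power V 1"
    unfolding subspace_power_def by (intro span_base CollectI exI[of _ "[x]"]) auto
  then show "x \<in> power_sum V 1" using subspace_power_subset[of 1 1 V] by blast
qed

lemma power_sum_exhausts:
  assumes "generates V"
  shows "(\<Union>n. power_sum V n) = UNIV"
proof -
  let ?U = "\<Union>n. power_sum V n"
  have 2: "\<exists>n. x \<in> power_sum V n \<and> y \<in> power_sum V n" if "x \<in> ?U" "y \<in> ?U" for x y
  proof -
    from that obtain i j where "x \<in> power_sum V i" "y \<in> power_sum V j" by blast
    then have "x \<in> power_sum V (max i j)" "y \<in> power_sum V (max i j)"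
      using power_sum_mono[of i "max i j" V] power_sum_mono[of j "max i j" V] by auto
    then show ?thesis by blast
  qed
  have "subspace ?U"
    unfolding subspace_def
  proof (intro conjI ballI allI)
    show "0 \<in> ?U" using subspace_0[OF subspace_power_sum] by blast
    show "x + y \<in> ?U" if "x \<in> ?U" "y \<in> ?U" for x y
      using 2[OF that] subspace_add[OF subspace_power_sum] by blast
    show "scale c x \<in> ?U" if "x \<in> ?U" for c x
      using that subspace_scale[OF subspace_power_sum] by blast
  qed
  moreover have "1 \<in> ?U" using one_in_power_sum by blast
  moreover have "x * y \<in> ?U" if xy: "x \<in> ?U" "y \<in> ?U" for x y
  proof -
    obtain n where "x \<in> power_sum V n" "y \<in> power_sum V n" using 2[OF xy] by blast
    then have "x * y \<in> power_sum V (n + n)" by (rule power_sum_mult)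
    then show ?thesis by blast
  qed
  ultimately have "subalgebra ?U" unfolding subalgebra_def by blast
  moreover have "V \<subseteq> ?U" using subset_power_sum by blast
  ultimately have "subalgebra hull V \<subseteq> ?U" by (intro hull_minimal)
  with assms show ?thesis unfolding generates_def by blast
qed

lemma finite_list_prods:
  assumes "finite B"
  shows "finite {prod_list xs | xs. length xs = m \<and> set xs \<subseteq> B}"
proof -
  have "{prod_list xs | xs. length xs = m \<and> set xs \<subseteq> B} = prod_list ` {xs. set xs \<subseteq> B \<and> length xs = m}"
    by blast
  then show ?thesis using finite_lists_length_eq[OF assms] by simp
qed

lemma subspace_power_span: "subspace_power (span B) m = subspace_power B m"
proof
  have "prod_list xs \<in> subspace_power B (length xs)" if "set xs \<subseteq> span B" for xs
    using that
  proof (induction xs)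
    case Nil
    then show ?case unfolding subspace_power_def by (intro span_base) auto
  next
    case (Cons x xs)
    have "B \<subseteq> {prod_list xs | xs. length xs = 1 \<and> set xs \<subseteq> B}"
    proof
      fix b assume "b \<in> B"
      then show "b \<in> {prod_list xs | xs. length xs = 1 \<and> set xs \<subseteq> B}"
        by (intro CollectI exI[of _ "[b]"]) auto
    qed
    then have "span B \<subseteq> subspace_power B 1"
      unfolding subspace_power_def by (rule span_mono)
    with Cons.prems have x: "x \<in> subspace_power B 1" by auto
    from subspace_power_mult[OF x, of "prod_list xs" "length xs"] Cons
    show ?case by simp
  qed
  then show "subspace_power (span B) m \<subseteq> subspace_power B m"
    unfolding subspace_power_def[of "span B"]
    by (intro span_minimal) (auto simp: subspace_power_def)
  show "subspace_power B m \<subseteq> subspace_power (span B) m"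
    unfolding subspace_power_def using span_superset[of B] by (intro span_mono) blast
qed

lemma fin_dim_power_sum:
  assumes "fin_dim V"
  shows "fin_dim (power_sum V n)"
proof -
  obtain B where B: "finite B" "V = span B" using assms unfolding fin_dim_def by blast
  let ?P = "\<lambda>i. {prod_list xs | xs. length xs = i \<and> set xs \<subseteq> B}"
  have "power_sum V n = span (\<Union>i\<le>n. span (?P i))"
    unfolding power_sum_def B(2) subspace_power_span by (simp add: subspace_power_def)
  also have "\<dots> = span (\<Union>i\<le>n. ?P i)"
  proof (rule antisym)
    show "span (\<Union>i\<le>n. span (?P i)) \<subseteq> span (\<Union>i\<le>n. ?P i)"
      by (intro span_minimal UN_least span_mono) auto
    show "span (\<Union>i\<le>n. ?P i) \<subseteq> span (\<Union>i\<le>n. span (?P i))"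
      by (intro span_mono UN_mono span_superset) auto
  qed
  finally show ?thesis
    unfolding fin_dim_def using finite_list_prods[OF B(1)] by (intro exI conjI) auto
qed

lemma fin_dim_dim_mono:
  assumes "U \<subseteq> W" "fin_dim W"
  shows "dim U \<le> dim W"
proof -
  obtain B where B: "finite B" "W = span B" using assms unfolding fin_dim_def by blast
  obtain C where C: "C \<subseteq> W" "independent C" "W \<subseteq> span C" "card C = dim W"
    by (rule basis_exists)
  have "finite C" using independent_span_bound[of B C] B C by auto
  then have "dim U \<le> card C" using assms C by (intro dim_le_card) auto
  then show ?thesis using C by simp
qed

lemma growth_fun_comparison:
  assumes V: "generating_space V" and W: "generating_space W"
  shows "\<exists>p>0. \<forall>n. growth_fun W n \<le> growth_fun V (p * n)"
proof -
  obtain B where B: "finite B" "W = span B"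
    using W unfolding generating_space_def fin_dim_def by blast
  have "\<exists>k. b \<in> power_sum V k" for b
    using power_sum_exhausts[of V] V unfolding generating_space_def by blast
  then obtain k where k: "\<And>b. b \<in> power_sum V (k b)" by metis
  define p where "p = Suc (\<Sum>b\<in>B. k b)"
  have "b \<in> power_sum V p" if "b \<in> B" for b
  proof -
    have "k b \<le> (\<Sum>b\<in>B. k b)" using B(1) that by (intro member_le_sum) auto
    then have "k b \<le> p" unfolding p_def by simp
    then show ?thesis using k power_sum_mono by blast
  qed
  then have WV: "W \<subseteq> power_sum V p"
    unfolding B(2) by (intro span_minimal subspace_power_sum) blast
  have prods: "prod_list xs \<in> power_sum V (p * length xs)" if "set xs \<subseteq> W" for xs
    using that
  proof (induction xs)
    case Nil
    then show ?case by (simp add: one_in_power_sum)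
  next
    case (Cons x xs)
    then have "x * prod_list xs \<in> power_sum V (p + p * length xs)"
      using WV by (intro power_sum_mult) auto
    then show ?case by simp
  qed
  have "subspace_power W i \<subseteq> power_sum V (p * n)" if "i \<le> n" for i n
  proof -
    have "p * i \<le> p * n" using that by simp
    then show ?thesis
      unfolding subspace_power_def
      using prods power_sum_mono by (intro span_minimal subspace_power_sum) blast
  qed
  then have "power_sum W n \<subseteq> power_sum V (p * n)" for n
    unfolding power_sum_def[of W] by (intro span_minimal subspace_power_sum) blast
  then have "\<forall>n. growth_fun W n \<le> growth_fun V (p * n)"
    unfolding growth_fun_def using V
    by (auto intro!: fin_dim_dim_mono fin_dim_power_sum simp: generating_space_def)
  then show ?thesis by (intro exI[of _ p]) (simp add: p_def)
qed

lemma growth_fun_equiv: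
  assumes "generating_space V" "generating_space W"
  shows "growth_equiv (\<lambda>n. real (growth_fun V n)) (\<lambda>n. real (growth_fun W n))"
proof -
  have "growth_le (\<lambda>n. real (growth_fun V n)) (\<lambda>n. real (growth_fun W n))"
    if VW: "generating_space V" "generating_space W" for V W
  proof -
    from growth_fun_comparison[OF VW(2,1)]
    obtain p where "\<forall>n. growth_fun V n \<le> growth_fun W (p * n)" by (elim exE conjE)
    then show ?thesis
      unfolding growth_le_def by (intro exI[of _ 1] exI[of _ p]) simp
  qed
  from this[OF assms] this[OF assms(2,1)] show ?thesis unfolding growth_equiv_def ..
qed

lemma affine_algebra_iff: "affine_algebra \<longleftrightarrow> (\<exists>V. generating_space V)"
proof
  assume "affine_algebra"
  then obtain S where S: "finite S" "generates S"
    unfolding affine_algebra_def by (elim exE conjE)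
  have "subalgebra hull S \<subseteq> subalgebra hull (span S)"
    by (intro hull_mono span_superset)
  then have "generates (span S)" using S(2) unfolding generates_def by (simp add: top.extremum_unique)
  moreover have "fin_dim (span S)" unfolding fin_dim_def using S(1) by (intro exI[of _ S]) simp
  ultimately have "generating_space (span S)"
    unfolding generating_space_def by simp
  then show "\<exists>V. generating_space V" by (rule exI)
next
  assume "\<exists>V. generating_space V"
  then obtain V B where V: "generates V" "finite B" "V = span B"
    unfolding generating_space_def fin_dim_def by (elim exE conjE)
  have "subalgebra hull V \<subseteq> subalgebra hull B"
    unfolding hull_def
  proof (intro Inter_anti_mono subsetI CollectI)
    fix C assume "C \<in> {t. subalgebra t \<and> B \<subseteq> t}"
    then show "subalgebra C \<and> V \<subseteq> C"
      unfolding V(3) subalgebra_def using span_minimal[of B C] by simp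
  qed
  then have "generates B" using V(1) unfolding generates_def by (simp add: top.extremum_unique)
  with V(2) show "affine_algebra" unfolding affine_algebra_def by (intro exI[of _ B]) simp
qed

lemma algebra_growth_eq:
  assumes "generating_space V"
  shows "algebra_growth = growth_class (\<lambda>n. real (growth_fun V n))"
  unfolding algebra_growth_def
  by (rule growth_class_cong[OF growth_fun_equiv[OF someI[of generating_space, OF assms] assms]])

lemma GKdim_le:
  assumes "generating_space V" "generating_space W"
  shows "limsup (\<lambda>n. ereal (ln (real (growth_fun W n)) / ln (real n)))
       \<le> limsup (\<lambda>n. ereal (ln (real (growth_fun V n)) / ln (real n)))" (is "?L \<le> ?R")
proof (rule ereal_le_real)
  obtain p where p: "p > 0" "\<And>n. growth_fun W n \<le> growth_fun V (p * n)"
    using growth_fun_comparison[OF assms] by (elim exE conjE) (rule that, assumption, erule spec)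
  fix C assume C: "?R \<le> ereal C"
  show "?L \<le> ereal C"
  proof (rule ereal_le_epsilon2)
    fix e :: real assume e: "e > 0"
    have lim: "(\<lambda>n. (C + e) * (ln (real p) + ln (real n)) / ln (real n)) \<longlonglongrightarrow> C + e"
    proof -
      have "filterlim (\<lambda>n. ln (real n)) at_top sequentially"
        by (rule filterlim_compose[OF ln_at_top filterlim_real_sequentially])
      then have "(\<lambda>n. ln (real p) / ln (real n)) \<longlonglongrightarrow> 0"
        by (intro real_tendsto_divide_at_top[OF tendsto_const])
      then have "(\<lambda>n. (C + e) * (ln (real p) / ln (real n) + 1)) \<longlonglongrightarrow> (C + e) * (0 + 1)"
        by (intro tendsto_intros)
      moreover have "\<forall>\<^sub>F n in sequentially. (C + e) * (ln (real p) / ln (real n) + 1) =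
          (C + e) * (ln (real p) + ln (real n)) / ln (real n)"
        using eventually_gt_at_top[of 1] by eventually_elim (simp add: field_simps)
      ultimately show ?thesis using tendsto_cong by force
    qed
    have "?R < ereal (C + e)"
      using C e by (meson ereal_less_eq(3) le_less_trans less_add_same_cancel1 less_ereal.simps(1))
    from Limsup_lessD[OF this]
    obtain N where N: "\<And>n. n \<ge> N \<Longrightarrow> ln (real (growth_fun V n)) / ln (real n) < C + e"
      unfolding eventually_sequentially by auto
    have "\<forall>\<^sub>F n in sequentially. ereal (ln (real (growth_fun W n)) / ln (real n))
        \<le> ereal ((C + e) * (ln (real p) + ln (real n)) / ln (real n))"
      using eventually_ge_at_top[of "N + 2"]
    proof eventually_elim
      case (elim n)
      have pn: "p * n \<ge> n" using p(1) by simp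
      have "ln (real (growth_fun W n)) \<le> ln (real (growth_fun V (p * n)))"
      proof (cases "growth_fun W n = 0")
        case True
        then show ?thesis by (cases "growth_fun V (p * n) = 0") simp_all
      next
        case False
        then show ?thesis using p(2)[of n] by (subst ln_le_cancel_iff) auto
      qed
      also have "\<dots> \<le> (C + e) * ln (real (p * n))"
      proof -
        have "p * n \<ge> 2" using pn elim by linarith
        then have "real (p * n) > 1" by linarith
        then have "ln (real (p * n)) > 0" by (rule ln_gt_zero)
        moreover have "p * n \<ge> N" using pn elim by linarith
        ultimately show ?thesis using N[of "p * n"] by (simp add: pos_divide_less_eq less_imp_le)
      qed
      also have "ln (real (p * n)) = ln (real p) + ln (real n)"
        using p(1) elim by (simp add: ln_mult)
      finally have "ln (real (growth_fun W n)) \<le> (C + e) * (ln (real p) + ln (real n))" .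
      moreover have "ln (real n) > 0" using elim by (intro ln_gt_zero) simp
      ultimately show ?case by (simp add: divide_right_mono)
    qed
    then have "?L \<le> limsup (\<lambda>n. ereal ((C + e) * (ln (real p) + ln (real n)) / ln (real n)))"
      by (rule Limsup_mono)
    also have "\<dots> = ereal (C + e)"
      by (intro lim_imp_Limsup) (use lim in auto)
    finally show "?L \<le> ereal C + ereal e" by simp
  qed
qed

lemma GKdim_eq:
  assumes "generating_space V"
  shows "GKdim = limsup (\<lambda>n. ereal (ln (real (growth_fun V n)) / ln (real n)))"
  unfolding GKdim_def
  using someI[of generating_space, OF assms] assms by (intro antisym GKdim_le)

end

end

theory Submission
  imports Defs
begin

text \<open>
  The point is that the growth function \<open>d\<close> of a generating space is submultiplicative, so
  a lower bound \<open>r ^ n \<le> d n\<close> that holds for infinitely many \<open>n\<close> already holds for all \<open>n\<close>: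
  if \<open>d m < r ^ m\<close> for a single \<open>m\<close>, then \<open>d n / r ^ n\<close> tends to \<open>0\<close>
  (\<open>submultiplicative_lower_bound\<close>). This is what turns the limit superior in the entropy, which
  only sees a subsequence, into a bound for the growth function on all of \<open>\<nat>\<close>.

  To compare entropy and growth one needs a generating space \<open>V\<close> with
  \<open>dim (A n) \<le> d n\<close>. Take \<open>V = A 0 + \<dots> + A D\<close>, where \<open>D\<close> is so large that \<open>V\<close> contains
  \<open>1\<close> and a finite set of generators. Because the whole of \<open>A 0\<close> lies in \<open>V\<close>, factors of
  degree \<open>0\<close> can be absorbed into their neighbours, and every homogeneous component of degree
  above \<open>D\<close> is spanned by products of two factors of smaller positive degree
  (\<open>component_decomposable\<close>). Splitting factors repeatedly writes an element of degree
  \<open>n > 0\<close> as a sum of products of at most \<open>n\<close> factors from \<open>V\<close>, whence \<open>A n \<subseteq> power_sum V n\<close>.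

  Now suppose that the entropy exceeds \<open>1\<close> and choose \<open>r > 1\<close> below it. Then \<open>r ^ n \<le> d n\<close> for
  infinitely many \<open>n\<close>, so for all \<open>n\<close>; since also \<open>d n \<le> d 1 ^ n\<close>, the growth is exponential.
  The lower bound forces \<open>ln (d n) / ln n\<close> to diverge, so finite Gelfand-Kirillov dimension implies
  entropy at most \<open>1\<close>. Finally, an \<open>n\<close>-th root of a positive integer is at least \<open>1\<close>, so entropy
  below \<open>1\<close> means that \<open>A n\<close> vanishes for large \<open>n\<close>, and then the entropy is \<open>0\<close>.
\<close>


section \<open>Submultiplicative sequences\<close>

lemma submultiplicative_power_le:
  fixes e :: "nat \<Rightarrow> real"
  assumes "\<And>n. e n \<ge> 0" "\<And>m n. e (m + n) \<le> e m * e n"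
  shows "e (m * k + s) \<le> e m ^ k * e s"
proof (induction k)
  case (Suc k)
  have "e (m * Suc k + s) = e (m + (m * k + s))" by (simp add: algebra_simps)
  also have "\<dots> \<le> e m * e (m * k + s)" by (rule assms)
  also have "\<dots> \<le> e m * (e m ^ k * e s)" by (intro mult_left_mono Suc assms)
  finally show ?case by (simp add: mult.assoc)
qed simp

text \<open>Division with remainder by \<open>m\<close> bounds \<open>e n\<close> by \<open>e m ^ (n div m)\<close> times the largest of the
  finitely many values at remainders.\<close>

lemma submultiplicative_tendsto_0:
  fixes e :: "nat \<Rightarrow> real"
  assumes nonneg: "\<And>n. e n \<ge> 0" and sub: "\<And>m n. e (m + n) \<le> e m * e n" and m: "e m < 1"
  shows "e \<longlonglongrightarrow> 0"
proof (cases "m = 0")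
  case True
  have "e n = 0" for n
  proof (rule ccontr)
    assume "e n \<noteq> 0"
    then have "e 0 * e n < 1 * e n"
      using nonneg[of n] m True by (intro mult_strict_right_mono) auto
    then show False using sub[of 0 n] by simp
  qed
  then have "e = (\<lambda>n. 0)" by blast
  then show ?thesis by simp
next
  case False
  define C where "C = (\<Sum>s<m. e s)"
  have "e n \<le> e m ^ (n div m) * C" for n
  proof -
    have "e n = e (m * (n div m) + n mod m)" by simp
    also have "\<dots> \<le> e m ^ (n div m) * e (n mod m)"
      by (rule submultiplicative_power_le[OF nonneg sub])
    also have "\<dots> \<le> e m ^ (n div m) * C"
      unfolding C_def using False nonneg by (intro mult_left_mono member_le_sum) auto
    finally show ?thesis .
  qed
  moreover have "(\<lambda>n. e m ^ (n div m) * C) \<longlonglongrightarrow> 0"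
  proof -
    have "filterlim (\<lambda>n. n div m) sequentially sequentially"
      using False by (intro filterlim_at_top_div_const_nat) auto
    moreover have "(\<lambda>n. e m ^ n) \<longlonglongrightarrow> 0"
      using nonneg m by (intro LIMSEQ_realpow_zero)
    ultimately have "(\<lambda>n. e m ^ (n div m)) \<longlonglongrightarrow> 0"
      by (rule filterlim_compose[rotated])
    then show ?thesis by (rule tendsto_mult_left_zero)
  qed
  ultimately show ?thesis
    by (intro tendsto_sandwich[OF _ _ tendsto_const, of 0 e]) (simp_all add: nonneg)
qed

lemma submultiplicative_lower_bound:
  fixes d :: "nat \<Rightarrow> real"
  assumes nonneg: "\<And>n. d n \<ge> 0" and sub: "\<And>m n. d (m + n) \<le> d m * d n" and r: "r > 0"
    and freq: "\<exists>\<^sub>F n in sequentially. r ^ n \<le> d n"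
  shows "r ^ m \<le> d m"
proof (rule ccontr)
  assume "\<not> r ^ m \<le> d m"
  define e where "e n = d n / r ^ n" for n
  have "e \<longlonglongrightarrow> 0"
  proof (rule submultiplicative_tendsto_0)
    show "e m < 1" using \<open>\<not> r ^ m \<le> d m\<close> r by (simp add: e_def)
    show "e n \<ge> 0" for n using nonneg r by (simp add: e_def)
    show "e (i + j) \<le> e i * e j" for i j
      using sub[of i j] r by (simp add: e_def power_add divide_right_mono)
  qed
  then have "\<forall>\<^sub>F n in sequentially. e n < 1" by (rule order_tendstoD) simp
  then have "\<forall>\<^sub>F n in sequentially. \<not> r ^ n \<le> d n"
    by eventually_elim (use r in \<open>simp add: e_def\<close>)
  with freq show False by (simp add: frequently_def)
qed


section \<open>Growth functions of generating spaces\<close>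

context unital_algebra
begin

lemma fin_dim_basis:
  assumes "fin_dim V"
  obtains B where "finite B" "V \<subseteq> span B" "card B = dim V"
proof -
  obtain F where F: "finite F" "V = span F" using assms unfolding fin_dim_def by blast
  obtain B where B: "B \<subseteq> V" "independent B" "V \<subseteq> span B" "card B = dim V"
    by (rule basis_exists)
  have "finite B" using independent_span_bound[of F B] F B by auto
  with B that show thesis by blast
qed

text \<open>Cutting a word of length at most \<open>m + n\<close> after its first \<open>m\<close> letters shows that the products
  of two basis elements, one for each part, span \<open>power_sum V (m + n)\<close>.\<close>

lemma growth_fun_submult:
  assumes "fin_dim V"
  shows "growth_fun V (m + n) \<le> growth_fun V m * growth_fun V n"
proof -
  obtain B where B: "finite B" "power_sum V m \<subseteq> span B" "card B = growth_fun V m"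
    unfolding growth_fun_def using fin_dim_basis[OF fin_dim_power_sum[OF assms]] .
  obtain C where C: "finite C" "power_sum V n \<subseteq> span C" "card C = growth_fun V n"
    unfolding growth_fun_def using fin_dim_basis[OF fin_dim_power_sum[OF assms]] .
  have eq: "{a * b | a b. a \<in> B \<and> b \<in> C} = (\<lambda>(a, b). a * b) ` (B \<times> C)" (is "?P = _") by auto
  have short: "prod_list xs \<in> power_sum V k" if "length xs \<le> k" "set xs \<subseteq> V" for xs k
  proof -
    have "prod_list xs \<in> subspace_power V (length xs)"
      unfolding subspace_power_def using that(2) by (intro span_base) blast
    then show ?thesis using subspace_power_subset[OF that(1)] by blast
  qed
  have "prod_list xs \<in> span ?P" if "length xs \<le> m + n" "set xs \<subseteq> V" for xs
  proof -
    have "prod_list (take m xs) \<in> span B"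
      using short[of "take m xs" m] that B(2) set_take_subset[of m xs] by auto
    moreover have "prod_list (drop m xs) \<in> span C"
      using short[of "drop m xs" n] that C(2) set_drop_subset[of m xs] by auto
    ultimately have "prod_list (take m xs) * prod_list (drop m xs) \<in> span ?P"
      by (rule span_mult)
    then show ?thesis by (simp flip: prod_list.append)
  qed
  then have "subspace_power V i \<subseteq> span ?P" if "i \<le> m + n" for i
    unfolding subspace_power_def using that by (intro span_minimal) auto
  then have "power_sum V (m + n) \<subseteq> span ?P"
    unfolding power_sum_def by (intro span_minimal) auto
  then have "growth_fun V (m + n) \<le> card ?P"
    unfolding growth_fun_def using B C by (intro dim_le_card) (auto simp: eq)
  also have "\<dots> \<le> card (B \<times> C)"
    unfolding eq using B C by (intro card_image_le) auto
  finally show ?thesis using B C by (simp add: card_cartesian_product)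
qed

lemma growth_fun_le_power:
  assumes "fin_dim V"
  shows "growth_fun V n \<le> growth_fun V 1 ^ n"
proof (induction n)
  case 0
  have "subspace_power V 0 = span {1}"
    unfolding subspace_power_def by (rule arg_cong[of _ _ span]) auto
  then have "power_sum V 0 \<subseteq> span {1}" by (simp add: power_sum_def span_span)
  then have "growth_fun V 0 \<le> card {1 :: 'a}"
    unfolding growth_fun_def by (intro dim_le_card) auto
  then show ?case by simp
next
  case (Suc n)
  have "growth_fun V (Suc n) \<le> growth_fun V 1 * growth_fun V n"
    using growth_fun_submult[OF assms, of 1 n] by simp
  also have "\<dots> \<le> growth_fun V 1 * growth_fun V 1 ^ n" by (intro mult_left_mono Suc) auto
  finally show ?case by simp
qed

lemma exponential_growthI:
  assumes V: "generating_space V" and r: "r > 1" and ge: "\<And>n. r ^ n \<le> real (growth_fun V n)"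
  shows exponential_growth
proof -
  let ?d = "\<lambda>n. real (growth_fun V n)"
  have "growth_le ?d (\<lambda>n. exp (real n))"
    unfolding growth_le_def
  proof (intro exI allI)
    fix n
    have "?d n \<le> ?d 1 ^ n"
      using growth_fun_le_power[of V n] V by (simp add: generating_space_def flip: of_nat_power)
    also have "\<dots> \<le> exp (?d 1) ^ n"
      using exp_ge_add_one_self[of "?d 1"] by (intro power_mono) linarith+
    finally show "?d n \<le> real 1 * exp (real (growth_fun V 1 * n))"
      by (simp add: mult.commute flip: exp_of_nat_mult)
  qed
  moreover have "growth_le (\<lambda>n. exp (real n)) ?d"
  proof -
    obtain m :: nat where m: "exp 1 < r ^ m" using real_arch_pow[OF r] by blast
    have "exp (real n) \<le> ?d (m * n)" for n
    proof -
      have "exp (real n) = exp 1 ^ n" by (simp flip: exp_of_nat_mult)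
      also have "\<dots> \<le> (r ^ m) ^ n" using m by (intro power_mono) auto
      also have "\<dots> \<le> ?d (m * n)" using ge by (simp flip: power_mult)
      finally show ?thesis .
    qed
    then show ?thesis unfolding growth_le_def by (intro exI[of _ 1] exI[of _ m]) simp
  qed
  ultimately show ?thesis
    unfolding exponential_growth_def algebra_growth_eq[OF V]
    by (intro growth_class_cong) (simp add: growth_equiv_def)
qed

lemma GKdim_infiniteI:
  assumes V: "generating_space V" and r: "r > 1" and ge: "\<And>n. r ^ n \<le> real (growth_fun V n)"
  shows "GKdim = \<infinity>"
proof -
  let ?g = "\<lambda>n. ln (real (growth_fun V n)) / ln (real n)"
  have "\<forall>\<^sub>F x :: real in at_top. ln x / x > 0"
    using eventually_gt_at_top[of 1] by eventually_elim simp
  then have "filterlim (\<lambda>x :: real. inverse (ln x / x)) at_top at_top"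
    by (rule filterlim_inverse_at_top[OF ln_x_over_x_tendsto_0])
  then have "filterlim (\<lambda>x :: real. x / ln x) at_top at_top" by simp
  then have "filterlim (\<lambda>n. real n / ln (real n)) at_top sequentially"
    by (rule filterlim_compose[OF _ filterlim_real_sequentially])
  then have "filterlim (\<lambda>n. ln r * (real n / ln (real n))) at_top sequentially"
    using r by (intro filterlim_tendsto_pos_mult_at_top[OF tendsto_const]) auto
  moreover have "\<forall>\<^sub>F n in sequentially. ln r * (real n / ln (real n)) \<le> ?g n"
    using eventually_gt_at_top[of 1]
  proof eventually_elim
    case (elim n)
    have "ln (r ^ n) \<le> ln (real (growth_fun V n))"
      using r ge[of n] by (intro ln_mono) auto
    then have "real n * ln r \<le> ln (real (growth_fun V n))" using r by (simp add: ln_realpow)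
    then show ?case using elim by (simp add: divide_right_mono mult.commute)
  qed
  ultimately have "filterlim ?g at_top sequentially" by (rule filterlim_at_top_mono)
  then have "(\<lambda>n. ereal (?g n)) \<longlonglongrightarrow> \<infinity>" by (simp add: tendsto_PInfty_eq_at_top)
  then show ?thesis unfolding GKdim_eq[OF V] by (intro lim_imp_Limsup) auto
qed


section \<open>Generating spaces of graded algebras\<close>

lemma span_UN_imp_sum:
  fixes E :: "nat \<Rightarrow> 'a set"
  assumes E: "\<And>n. subspace (E n)" and x: "x \<in> span (\<Union>n. E n)"
  shows "\<exists>f. (\<forall>n. f n \<in> E n) \<and> finite {n. f n \<noteq> 0} \<and> x = (\<Sum>n | f n \<noteq> 0. f n)"
proof -
  have "\<exists>f I. (\<forall>n. f n \<in> E n) \<and> finite I \<and> (\<forall>n. n \<notin> I \<longrightarrow> f n = 0) \<and> x = sum f I"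
    using x
  proof (induction rule: span_induct_alt)
    case base
    show ?case using subspace_0[OF E] by (intro exI[of _ "\<lambda>n. 0"] exI[of _ "{}"]) simp
  next
    case (step c b y)
    then obtain k where k: "b \<in> E k" by blast
    from step obtain f I where f: "\<And>n. f n \<in> E n" "finite I" "\<And>n. n \<notin> I \<Longrightarrow> f n = 0" "y = sum f I"
      by blast
    define g where "g = (\<lambda>n. (if n = k then scale c b else 0) + f n)"
    have "g n \<in> E n" for n
      unfolding g_def using f(1) k E by (simp add: subspace_add subspace_scale)
    moreover have "scale c b + y = sum g (insert k I)"
    proof -
      have "sum f (insert k I) = sum f I"
        using f by (cases "k \<in> I") (auto simp: insert_absorb)
      then show ?thesis using f(2,4) by (simp add: g_def sum.distrib sum.delta)
    qed
    ultimately show ?case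
      using f by (intro exI[of _ g] exI[of _ "insert k I"]) (auto simp: g_def)
  qed
  then obtain f I where f: "\<forall>n. f n \<in> E n" "finite I" "\<forall>n. n \<notin> I \<longrightarrow> f n = 0" "x = sum f I"
    by blast
  have sub: "{n. f n \<noteq> 0} \<subseteq> I" using f(3) by blast
  then have "x = (\<Sum>n | f n \<noteq> 0. f n)"
    unfolding f(4) using f(2) by (intro sum.mono_neutral_right) auto
  with f sub show ?thesis using finite_subset by blast
qed

text \<open>A family of subspaces of the graded pieces that still spans the algebra consists of the
  pieces themselves, by uniqueness of the decomposition into homogeneous components.\<close>

lemma graded_spanning_subspaces:
  assumes A: "graded A" and E: "\<And>n. subspace (E n)" "\<And>n. E n \<subseteq> A n"
    and span: "span (\<Union>n. E n) = UNIV"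
  shows "A n \<subseteq> E n"
proof
  fix a assume a: "a \<in> A n"
  let ?dec = "\<lambda>f. (\<forall>n. f n \<in> A n) \<and> finite {n. f n \<noteq> 0} \<and> a = (\<Sum>n | f n \<noteq> 0. f n)"
  define g where "g = (\<lambda>i. if i = n then a else 0)"
  obtain f where f: "\<forall>n. f n \<in> E n" "finite {n. f n \<noteq> 0}" "a = (\<Sum>n | f n \<noteq> 0. f n)"
    using span_UN_imp_sum[of E a] E(1) span by auto
  have "?dec f" using f E(2) by blast
  moreover have "?dec g"
  proof (intro conjI allI)
    show "g i \<in> A i" for i
      using a A subspace_0[of "A i"] unfolding g_def graded_def by simp
    have "{i. g i \<noteq> 0} = (if a = 0 then {} else {n})" by (auto simp: g_def)
    then show "finite {i. g i \<noteq> 0}" "a = (\<Sum>i | g i \<noteq> 0. g i)" by (auto simp: g_def)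
  qed
  moreover have "\<exists>!f. ?dec f" using A unfolding graded_def by blast
  ultimately have "f = g" by blast
  with f(1) show "a \<in> E n" by (metis g_def)
qed

lemma finite_subset_low_degrees:
  assumes A: "graded A" and "finite T"
  shows "\<exists>D. T \<subseteq> span (\<Union>i\<le>D. A i)"
  using assms(2)
proof induction
  case (insert x T)
  then obtain D where D: "T \<subseteq> span (\<Union>i\<le>D. A i)" by blast
  obtain f where f: "\<forall>n. f n \<in> A n" "finite {n. f n \<noteq> 0}" "x = (\<Sum>n | f n \<noteq> 0. f n)"
    using A unfolding graded_def by blast
  obtain N where N: "\<And>n. f n \<noteq> 0 \<Longrightarrow> n \<le> N" using f(2) by (auto simp: finite_nat_set_iff_bounded_le)
  have mono: "span (\<Union>i\<le>M. A i) \<subseteq> span (\<Union>i\<le>max D N. A i)" if "M \<le> max D N" for M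
    using that by (intro span_mono UN_mono) auto
  have "x \<in> span (\<Union>i\<le>N. A i)"
    unfolding f(3) using f(1) N by (intro span_sum span_base) auto
  then show ?case using D mono[of N] mono[of D] by (intro exI[of _ "max D N"]) auto
qed simp

definition decomposables :: "(nat \<Rightarrow> 'a set) \<Rightarrow> nat \<Rightarrow> 'a set" where
  "decomposables A n = span {x * y | x y. \<exists>i j. 0 < i \<and> 0 < j \<and> i + j = n \<and> x \<in> A i \<and> y \<in> A j}"

lemma decomposables_subset:
  assumes "graded A"
  shows "decomposables A n \<subseteq> A n"
proof -
  have "subspace (A n)" "\<And>x y i j. x \<in> A i \<Longrightarrow> y \<in> A j \<Longrightarrow> x * y \<in> A (i + j)"
    using assms unfolding graded_def by blast+
  then show ?thesis
    unfolding decomposables_def by (intro span_minimal) blast+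
qed

text \<open>A factor of degree \<open>0\<close> merges with the neighbouring factor and leaves its degree unchanged.\<close>

lemma decomposables_mult_degree_0:
  assumes A: "graded A" and a: "a \<in> A 0" and x: "x \<in> decomposables A n"
  shows "a * x \<in> decomposables A n" "x * a \<in> decomposables A n"
proof -
  let ?P = "{x * y | x y. \<exists>i j. 0 < i \<and> 0 < j \<and> i + j = n \<and> x \<in> A i \<and> y \<in> A j}"
  have A_mult: "u * v \<in> A (i + j)" if "u \<in> A i" "v \<in> A j" for u v i j
    using A that unfolding graded_def by blast
  have "{b * p | b p. b \<in> {a} \<and> p \<in> ?P} \<subseteq> ?P"
  proof clarify
    fix u v i j assume uv: "0 < i" "0 < j" "u \<in> A i" "v \<in> A j" "n = i + j"
    have "a * (u * v) = (a * u) * v" "a * u \<in> A i"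
      using A_mult[OF a uv(3)] by (simp_all add: mult.assoc)
    with uv show "\<exists>x y. a * (u * v) = x * y \<and>
        (\<exists>i' j'. 0 < i' \<and> 0 < j' \<and> i' + j' = i + j \<and> x \<in> A i' \<and> y \<in> A j')"
      by blast
  qed
  from span_mono[OF this] show "a * x \<in> decomposables A n"
    using span_mult[of a "{a}" x ?P] x span_base[of a "{a}"] unfolding decomposables_def by blast
  have "{p * b | p b. p \<in> ?P \<and> b \<in> {a}} \<subseteq> ?P"
  proof clarify
    fix u v i j assume uv: "0 < i" "0 < j" "u \<in> A i" "v \<in> A j" "n = i + j"
    have "(u * v) * a = u * (v * a)" "v * a \<in> A j"
      using A_mult[OF uv(4) a] by (simp_all add: mult.assoc)
    with uv show "\<exists>x y. u * v * a = x * y \<and>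
        (\<exists>i' j'. 0 < i' \<and> 0 < j' \<and> i' + j' = i + j \<and> x \<in> A i' \<and> y \<in> A j')"
      by blast
  qed
  from span_mono[OF this] show "x * a \<in> decomposables A n"
    using span_mult[of x ?P a "{a}"] x span_base[of a "{a}"] unfolding decomposables_def by blast
qed

text \<open>The pieces of degree at most \<open>D\<close> and the decomposables above \<open>D\<close> are closed under
  multiplication: a product that lands above \<open>D\<close> is decomposable by definition unless a factor has
  degree \<open>0\<close>, and in that case the other factor is decomposable already. So together they
  span a subalgebra that contains the generators.\<close>

lemma component_decomposable:
  assumes A: "graded A" and V: "generates (span (\<Union>i\<le>D. A i))" "1 \<in> span (\<Union>i\<le>D. A i)" and n: "n > D"
  shows "A n \<subseteq> decomposables A n"
proof -
  define E where "E n = (if n \<le> D then A n else decomposables A n)" for n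
  have E_A: "E n \<subseteq> A n" for n unfolding E_def using decomposables_subset[OF A] by auto
  have E_subspace: "subspace (E n)" for n
    using A unfolding E_def graded_def decomposables_def by auto
  have E_mult: "x * y \<in> E (i + j)" if xy: "x \<in> E i" "y \<in> E j" for x y i j
  proof -
    have xyA: "x \<in> A i" "y \<in> A j" using xy E_A by auto
    consider "i + j \<le> D" | "i + j > D" "i = 0" | "i + j > D" "j = 0" | "i + j > D" "i > 0" "j > 0"
      by linarith
    then show ?thesis
    proof cases
      case 1
      then show ?thesis using xyA A unfolding E_def graded_def by simp
    next
      case 2
      then show ?thesis using xy xyA decomposables_mult_degree_0(1)[OF A] by (simp add: E_def)
    next
      case 3
      then show ?thesis using xy xyA decomposables_mult_degree_0(2)[OF A] by (simp add: E_def)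
    next
      case 4
      then have "x * y \<in> decomposables A (i + j)"
        unfolding decomposables_def using xyA by (intro span_base) blast
      then show ?thesis using 4 by (simp add: E_def)
    qed
  qed
  let ?C = "span (\<Union>n. E n)"
  have V_C: "span (\<Union>i\<le>D. A i) \<subseteq> ?C"
    by (intro span_mono UN_least) (auto simp: E_def)
  have "{a * b | a b. a \<in> (\<Union>n. E n) \<and> b \<in> (\<Union>n. E n)} \<subseteq> (\<Union>n. E n)"
    using E_mult by blast
  from span_mono[OF this] have "x * y \<in> ?C" if "x \<in> ?C" "y \<in> ?C" for x y
    using span_mult[OF that] by blast
  then have "subalgebra ?C" unfolding subalgebra_def using V_C V(2) by auto
  then have "subalgebra hull (span (\<Union>i\<le>D. A i)) \<subseteq> ?C" by (intro hull_minimal V_C)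
  then have "?C = UNIV" using V(1) unfolding generates_def by auto
  from graded_spanning_subspaces[OF A E_subspace E_A this, of n] show ?thesis
    using n by (simp add: E_def)
qed

text \<open>Both factors of a decomposable have positive degree, so the induction ends in factors of
  positive degree from \<open>V\<close>, and there are no more of these than the total degree.\<close>

lemma component_subset_power_sum:
  assumes A: "graded A" and V: "generates (span (\<Union>i\<le>D. A i))" "1 \<in> span (\<Union>i\<le>D. A i)"
  shows "n > 0 \<Longrightarrow> A n \<subseteq> power_sum (span (\<Union>i\<le>D. A i)) n"
proof (induction n rule: less_induct)
  case (less n)
  let ?V = "span (\<Union>i\<le>D. A i)"
  show ?case
  proof (cases "n \<le> D")
    case True
    then have "A n \<subseteq> ?V" using span_superset[of "\<Union>i\<le>D. A i"] by blast
    also have "\<dots> \<subseteq> power_sum ?V 1" by (rule subset_power_sum)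
    also have "\<dots> \<subseteq> power_sum ?V n" using less.prems by (intro power_sum_mono) simp
    finally show ?thesis .
  next
    case False
    then have "A n \<subseteq> decomposables A n" by (intro component_decomposable[OF A V]) simp
    also have "\<dots> \<subseteq> power_sum ?V n"
      unfolding decomposables_def
    proof (intro span_minimal subspace_power_sum, clarify)
      fix x y i j assume "0 < i" "0 < j" "x \<in> A i" "y \<in> A j" "n = i + j"
      then show "x * y \<in> power_sum ?V (i + j)"
        using less.IH[of i] less.IH[of j] by (intro power_sum_mult) auto
    qed
    finally show ?thesis .
  qed
qed

lemma graded_generating_space:
  assumes "affine_algebra" and A: "graded A" and fin: "\<And>n. fin_dim (A n)"
  obtains V where "generating_space V" "\<And>n. n > 0 \<Longrightarrow> dim (A n) \<le> growth_fun V n"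
proof -
  obtain S where S: "finite S" "generates S" using assms(1) unfolding affine_algebra_def by auto
  \<comment> \<open>Including \<open>1\<close> among the generators avoids a proof that it is homogeneous of degree \<open>0\<close>.\<close>
  obtain D where D: "insert 1 S \<subseteq> span (\<Union>i\<le>D. A i)" (is "_ \<subseteq> ?V")
    using finite_subset_low_degrees[OF A, of "insert 1 S"] S(1) by auto
  have "subalgebra hull S \<subseteq> subalgebra hull ?V" using D by (intro hull_mono) auto
  then have gen: "generates ?V" using S(2) unfolding generates_def by auto
  obtain B where B: "\<And>n. finite (B n)" "\<And>n. A n = span (B n)"
    using fin unfolding fin_dim_def by metis
  have "?V = span (\<Union>i\<le>D. B i)"
  proof (rule antisym)
    show "?V \<subseteq> span (\<Union>i\<le>D. B i)"
      unfolding B(2) by (intro span_minimal UN_least span_mono) auto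
    show "span (\<Union>i\<le>D. B i) \<subseteq> ?V"
      unfolding B(2) by (intro span_mono UN_mono span_superset) auto
  qed
  then have finV: "fin_dim ?V"
    unfolding fin_dim_def using B(1) by (intro exI[of _ "\<Union>i\<le>D. B i"]) auto
  show thesis
  proof (rule that)
    show "generating_space ?V" unfolding generating_space_def using gen finV by simp
    show "dim (A n) \<le> growth_fun ?V n" if "n > 0" for n
      unfolding growth_fun_def
      using D by (intro fin_dim_dim_mono fin_dim_power_sum finV
          component_subset_power_sum[OF A gen] that) auto
  qed
qed


section \<open>Entropy\<close>

lemma entropy_gt_1_imp_growth_ge:
  assumes V: "generating_space V" "\<And>n. n > 0 \<Longrightarrow> dim (A n) \<le> growth_fun V n"
    and H: "entropy A > 1"
  obtains r where "r > 1" "\<And>n. r ^ n \<le> real (growth_fun V n)"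
proof -
  obtain r where r: "1 < ereal r" "ereal r < entropy A" using ereal_dense2[OF H] by auto
  then have r1: "r > 1" by simp
  have "\<exists>\<^sub>F n in sequentially. r ^ n \<le> real (growth_fun V n)"
  proof (rule ccontr)
    assume "\<not> ?thesis"
    then have "\<forall>\<^sub>F n in sequentially. \<not> r ^ n \<le> real (growth_fun V n)"
      by (simp add: not_frequently)
    then have "\<forall>\<^sub>F n in sequentially. ereal (root n (real (dim (A n)))) \<le> ereal r"
      using eventually_gt_at_top[of 0]
    proof eventually_elim
      case (elim n)
      then have "real (dim (A n)) \<le> r ^ n" using V(2)[of n] by linarith
      then have "root n (real (dim (A n))) \<le> root n (r ^ n)" using elim by simp
      also have "\<dots> = r" using elim r1 by (intro real_root_power_cancel) auto
      finally show ?case by simp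
    qed
    then have "entropy A \<le> ereal r" unfolding entropy_def by (rule Limsup_bounded)
    with r show False by simp
  qed
  then have "r ^ n \<le> real (growth_fun V n)" for n
  proof (rule submultiplicative_lower_bound[rotated 3])
    show "real (growth_fun V (i + j)) \<le> real (growth_fun V i) * real (growth_fun V j)" for i j
      using growth_fun_submult[of V i j] V(1)
      by (simp add: generating_space_def flip: of_nat_mult)
  qed (use r1 in auto)
  with r1 that show thesis by blast
qed

text \<open>A nonzero dimension has all its roots at least \<open>1\<close>.\<close>

lemma entropy_gap: "entropy A = 0 \<or> entropy A \<ge> 1"
proof (cases "\<forall>\<^sub>F n in sequentially. dim (A n) = 0")
  case True
  then have "\<forall>\<^sub>F n in sequentially. ereal (root n (real (dim (A n)))) = 0"
    by eventually_elim simp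
  then have "entropy A = limsup (\<lambda>n :: nat. 0 :: ereal)"
    unfolding entropy_def by (rule Limsup_eq)
  then show ?thesis by (simp add: Limsup_const)
next
  case False
  have "entropy A \<ge> 1"
  proof (rule ccontr)
    assume "\<not> entropy A \<ge> 1"
    then have "\<forall>\<^sub>F n in sequentially. ereal (root n (real (dim (A n)))) < 1"
      unfolding entropy_def by (intro Limsup_lessD) simp
    then have "\<forall>\<^sub>F n in sequentially. dim (A n) = 0"
      using eventually_gt_at_top[of 0] by eventually_elim simp
    with False show False ..
  qed
  then show ?thesis ..
qed

end

theorem theorem4p13:
  fixes scale :: "'k :: field \<Rightarrow> 'a :: {ring, monoid_mult} \<Rightarrow> 'a"
    and A :: "nat \<Rightarrow> 'a set"
  assumes "unital_algebra scale"
    and "unital_algebra.affine_algebra scale"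
    and "unital_algebra.graded scale A"
    and "\<And>n. unital_algebra.fin_dim scale (A n)"
  shows "(unital_algebra.entropy scale A > 1 \<longrightarrow> unital_algebra.exponential_growth scale) \<and>
         (unital_algebra.GKdim scale < \<infinity> \<longrightarrow>
            unital_algebra.entropy scale A = 1 \<or> unital_algebra.entropy scale A = 0)"
proof -
  interpret unital_algebra scale by (rule assms(1))
  obtain V where V: "generating_space V" "\<And>n. n > 0 \<Longrightarrow> dim (A n) \<le> growth_fun V n"
    using graded_generating_space[OF assms(2-4)] by blast
  have "exponential_growth \<and> GKdim = \<infinity>" if H: "entropy A > 1"
  proof -
    obtain r where "r > 1" "\<And>n. r ^ n \<le> real (growth_fun V n)"
      using entropy_gt_1_imp_growth_ge[OF V H] by blast
    then show ?thesis using exponential_growthI GKdim_infiniteI V(1) by blast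
  qed
  then show ?thesis using entropy_gap[of A] by force
qed

end
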